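(* Let $\mathcal{P}=\{1,\dots,\kappa\}$ and $\mathcal{Q}=\{1,\dots,m\}$ be finite sets, let $\mathcal{I}$ be the set of feasible allocations, let $\Omega_i$ be the finite non-empty set of admissible routes of provider $i\in\mathcal{P}$, let $F(\mathscr{S})=\sum_{i=1}^{\kappa}f_i(\mathcal{S}_i)$ with $f_i:2^{\mathcal{Q}}\to\mathbb{R}_{\ge 0}$ submodular, and let $T(\mathscr{S},\mathscr{R})\in\mathbb{R}$ be the routing cost, supermodular in $\mathscr{S}$ for each fixed $\mathscr{R}$. For any $\alpha>0$, the joint optimization problem $$\max_{\mathscr{S},\mathscr{R}}\; F(\mathscr{S})-\alpha\,T(\mathscr{S},\mathscr{R})\quad\text{subject to}\quad \mathscr{S}\in\mathcal{I},\;\; \mathcal{R}_i\in\Omega_i\ \ \forall i\in\mathcal{P},$$ is equivalent to the single-variable problem $$\max_{\mathscr{S}\in\mathcal{I}}\Bigl(F(\mathscr{S})-\alpha\,T\bigl(\mathscr{S},\mathscr{R}^\star(\mathscr{S})\bigr)\Bigr),$$ where, for each fixed $\mathscr{S}\in\mathcal{I}$, the optimal routing is $$\mathscr{R}^\star(\mathscr{S})=\operatorname*{arg\,min}_{\mathscr{R}=(\mathcal{R}_1,\dots,\mathcal{R}_\kappa):\ \mathcal{R}_i\in\Omega_i\ \forall i\in\mathcal{P}} T(\mathscr{S},\mathscr{R}).$$ That is, the two problems have the same optimal value, and $\bar{\mathscr{S}}\in\mathcal{I}$ solves the single-variable problem if and only if $(\bar{\mathscr{S}},\mathscr{R}^\star(\bar{\mathscr{S}}))$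 solves the joint problem.
   Context: $\mathcal{G}=(\mathcal{V},\mathcal{E},w)$ is a finite directed graph with edge weights $w:\mathcal{E}\to\mathbb{R}_{\ge 0}$; providers are the nodes $\mathcal{P}=\{1,\dots,\kappa\}\subset\mathcal{V}$ and the client is a node $c\in\mathcal{V}$. $\Omega_i$ is a finite non-empty set of directed simple paths from $i$ to $c$. A routing assignment is a tuple $\mathscr{R}=(\mathcal{R}_1,\dots,\mathcal{R}_\kappa)$. The set of feasible allocations is $$\mathcal{I}=\Big\{\mathscr{S}=(\mathcal{S}_1,\dots,\mathcal{S}_\kappa)\;\Big|\;\mathcal{S}_i\subseteq\mathcal{Q},\ \mathcal{S}_i\cap\mathcal{S}_j=\emptyset\ \forall i\ne j,\ \bigcup_{i=1}^{\kappa}\mathcal{S}_i=\mathcal{Q}\Big\}.$$ Supermodularity in $\mathscr{S}$ is understood by identifying $\mathscr{S}$ with the subset $\{(i,q):q\in\mathcal{S}_i\}$ of $\mathcal{P}\times\mathcal{Q}$. $\mathscr{R}^\star(\mathscr{S})$ denotes a chosen minimizer (any choice) when the minimizer is not unique. *)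

theory Defs
  imports Complex_Main "HOL-Library.FuncSet" "Graph_Theory.Pair_Digraph"
begin

definition submodular_on :: "'a set \<Rightarrow> ('a set \<Rightarrow> real) \<Rightarrow> bool" where
  "submodular_on E g \<longleftrightarrow>
     (\<forall>A B. A \<subseteq> E \<longrightarrow> B \<subseteq> E \<longrightarrow> g (A \<union> B) + g (A \<inter> B) \<le> g A + g B)"

definition supermodular_on :: "'a set \<Rightarrow> ('a set \<Rightarrow> real) \<Rightarrow> bool" where
  "supermodular_on E g \<longleftrightarrow>
     (\<forall>A B. A \<subseteq> E \<longrightarrow> B \<subseteq> E \<longrightarrow> g A + g B \<le> g (A \<union> B) + g (A \<inter> B))"

text \<open>
  A tuple indexed by \<open>{1..\<kappa>}\<close> is an extensional function on \<open>{1..\<kappa>}\<close> (it is \<open>undefined\<close>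
  elsewhere), so that equality of functions is equality of tuples and there are only
  finitely many allocations and routing assignments.
\<close>

type_synonym allocation = "nat \<Rightarrow> nat set"

text \<open>A route is the list of its arcs.\<close>

type_synonym routing = "nat \<Rightarrow> (nat \<times> nat) list"

definition feasible_allocations :: "nat \<Rightarrow> nat \<Rightarrow> allocation set" where
  "feasible_allocations \<kappa> m =
     {S \<in> {1..\<kappa>} \<rightarrow>\<^sub>E Pow {1..m}.
        (\<forall>i\<in>{1..\<kappa>}. \<forall>j\<in>{1..\<kappa>}. i \<noteq> j \<longrightarrow> S i \<inter> S j = {}) \<and> (\<Union>i\<in>{1..\<kappa>}. S i) = {1..m}}"

definition routings :: "nat \<Rightarrow> (nat \<Rightarrow> (nat \<times> nat) list set) \<Rightarrow> routing set" where
  "routings \<kappa> \<Omega> = Pi\<^sub>E {1..\<kappa>} \<Omega>"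

text \<open>
  The tuple identified with a subset \<open>X\<close> of \<open>{1..\<kappa>} \<times> {1..m}\<close>. It need not be feasible:
  feasible allocations are not closed under union and intersection, so supermodularity of
  the routing cost is a condition on all tuples of subsets.
\<close>

definition allocation_of :: "nat \<Rightarrow> (nat \<times> nat) set \<Rightarrow> allocation" where
  "allocation_of \<kappa> X = (\<lambda>i\<in>{1..\<kappa>}. {q. (i, q) \<in> X})"

definition total_value :: "nat \<Rightarrow> (nat \<Rightarrow> nat set \<Rightarrow> real) \<Rightarrow> allocation \<Rightarrow> real" where
  "total_value \<kappa> f S = (\<Sum>i\<in>{1..\<kappa>}. f i (S i))"

definition optimal_routing ::
  "nat \<Rightarrow> (nat \<Rightarrow> (nat \<times> nat) list set) \<Rightarrow> (allocation \<Rightarrow> routing \<Rightarrow> real) \<Rightarrow>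
   allocation \<Rightarrow> routing \<Rightarrow> bool" where
  "optimal_routing \<kappa> \<Omega> T S R \<longleftrightarrow> is_arg_min (T S) (\<lambda>R. R \<in> routings \<kappa> \<Omega>) R"

lemma ex_optimal_routing:
  assumes "\<And>i. i \<in> {1..\<kappa>} \<Longrightarrow> finite (\<Omega> i) \<and> \<Omega> i \<noteq> {}"
  shows "\<exists>R. optimal_routing \<kappa> \<Omega> T S R"
  unfolding optimal_routing_def routings_def
  using assms by (intro ex_is_arg_min_if_finite) (auto intro: finite_PiE simp: PiE_eq_empty_iff)

end

theory Submission
  imports Defs
begin

text \<open>
  For a fixed allocation \<open>S\<close>, the value term does not depend on the routing and \<open>\<alpha> > 0\<close>, so
  a routing minimizing \<open>T S\<close> is one maximizing the whole objective over the fibre above \<open>S\<close>.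
  A joint maximum is therefore an iterated one: replacing the routing of a
  feasible pair by the optimal one for the same allocation never lowers the objective and
  keeps the pair feasible. The lemmas \<open>Max_partial_maximization\<close> and
  \<open>is_arg_max_partial_maximization\<close> state this for an arbitrary objective on a product set,
  the first for the optimal value and the second for the maximizers.

  The set of feasible allocations is empty when \<open>\<kappa> = 0\<close> and \<open>m > 0\<close>. Then both problems
  are empty, and their values agree because both are \<open>Max {}\<close>.
\<close>

text \<open>
  The two value sets dominate each other elementwise: the inner one is contained in the
  joint one, and conversely \<open>h x y \<le> h x (b x)\<close>. As this makes one set empty exactly when
  the other is, the lemma also covers the empty problem.
\<close>

lemma Max_partial_maximization:
  fixes h :: "'a \<Rightarrow> 'b \<Rightarrow> 'c::linorder"
  assumes "finite X" "finite Y"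
    and best_in: "\<And>x. x \<in> X \<Longrightarrow> b x \<in> Y"
    and best: "\<And>x y. x \<in> X \<Longrightarrow> y \<in> Y \<Longrightarrow> h x y \<le> h x (b x)"
  shows "Max {h x y | x y. x \<in> X \<and> y \<in> Y} = Max {h x (b x) | x. x \<in> X}"
proof (rule Max_eq_if)
  show "finite {h x y | x y. x \<in> X \<and> y \<in> Y}"
    using assms(1,2) by (simp add: finite_image_set2)
  show "finite {h x (b x) | x. x \<in> X}"
    using assms(1) by simp
qed (use best_in best in blast)+

lemma is_arg_max_partial_maximization:
  fixes h :: "'a \<Rightarrow> 'b \<Rightarrow> 'c::linorder"
  assumes best_in: "\<And>x. x \<in> X \<Longrightarrow> b x \<in> Y"
    and best: "\<And>x y. x \<in> X \<Longrightarrow> y \<in> Y \<Longrightarrow> h x y \<le> h x (b x)"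
  shows "is_arg_max (\<lambda>x. h x (b x)) (\<lambda>x. x \<in> X) x0 \<longleftrightarrow>
    is_arg_max (\<lambda>(x, y). h x y) (\<lambda>(x, y). x \<in> X \<and> y \<in> Y) (x0, b x0)"
  using best_in order.trans[OF best]
  by (fastforce simp: is_arg_max_linorder)

lemma finite_feasible_allocations: "finite (feasible_allocations \<kappa> m)"
  unfolding feasible_allocations_def
  by (rule finite_subset[of _ "{1..\<kappa>} \<rightarrow>\<^sub>E Pow {1..m}"]) (auto intro: finite_PiE)

theorem mainTheorem2:
  fixes G :: "nat pair_pre_digraph"
    and w :: "nat \<times> nat \<Rightarrow> real"
    and \<kappa> m c :: nat
    and \<Omega> :: "nat \<Rightarrow> (nat \<times> nat) list set"
    and f :: "nat \<Rightarrow> nat set \<Rightarrow> real"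
    and T :: "allocation \<Rightarrow> routing \<Rightarrow> real"
    and \<alpha> :: real
    and Rstar :: "allocation \<Rightarrow> routing"
  assumes graph: "pair_fin_digraph G"
    and weights: "\<forall>e\<in>parcs G. 0 \<le> w e"
    and providers: "{1..\<kappa>} \<subseteq> pverts G"
    and client: "c \<in> pverts G"
    and routes: "\<forall>i\<in>{1..\<kappa>}. finite (\<Omega> i) \<and> \<Omega> i \<noteq> {} \<and>
                   (\<forall>p\<in>\<Omega> i. pre_digraph.apath (with_proj G) i p c)"
    and f_nonneg: "\<forall>i\<in>{1..\<kappa>}. \<forall>A. A \<subseteq> {1..m} \<longrightarrow> 0 \<le> f i A"
    and f_submodular: "\<forall>i\<in>{1..\<kappa>}. submodular_on {1..m} (f i)"
    and T_supermodular: "\<forall>R\<in>routings \<kappa> \<Omega>.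
          supermodular_on ({1..\<kappa>} \<times> {1..m}) (\<lambda>X. T (allocation_of \<kappa> X) R)"
    and alpha_pos: "0 < \<alpha>"
    and Rstar: "\<forall>S\<in>feasible_allocations \<kappa> m. optimal_routing \<kappa> \<Omega> T S (Rstar S)"
  shows "Max {total_value \<kappa> f S - \<alpha> * T S R | S R.
                S \<in> feasible_allocations \<kappa> m \<and> R \<in> routings \<kappa> \<Omega>}
         = Max {total_value \<kappa> f S - \<alpha> * T S (Rstar S) | S. S \<in> feasible_allocations \<kappa> m}
     \<and> (\<forall>Sbar\<in>feasible_allocations \<kappa> m.
          is_arg_max (\<lambda>S. total_value \<kappa> f S - \<alpha> * T S (Rstar S))
                     (\<lambda>S. S \<in> feasible_allocations \<kappa> m) Sbar
          \<longleftrightarrow>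
          is_arg_max (\<lambda>(S, R). total_value \<kappa> f S - \<alpha> * T S R)
                     (\<lambda>(S, R). S \<in> feasible_allocations \<kappa> m \<and> R \<in> routings \<kappa> \<Omega>)
                     (Sbar, Rstar Sbar))"
proof -
  let ?h = "\<lambda>S R. total_value \<kappa> f S - \<alpha> * T S R"
  have fin: "finite (routings \<kappa> \<Omega>)"
    using routes by (auto simp: routings_def intro: finite_PiE)
  have best_in: "Rstar S \<in> routings \<kappa> \<Omega>" if "S \<in> feasible_allocations \<kappa> m" for S
    using Rstar that by (auto simp: optimal_routing_def is_arg_min_def)
  have best: "?h S R \<le> ?h S (Rstar S)"
    if "S \<in> feasible_allocations \<kappa> m" "R \<in> routings \<kappa> \<Omega>" for S R
  proof -
    have "T S (Rstar S) \<le> T S R"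
      using Rstar that by (auto simp: optimal_routing_def is_arg_min_linorder)
    then show ?thesis
      using alpha_pos by simp
  qed
  show ?thesis
    using Max_partial_maximization[where h = ?h, OF finite_feasible_allocations fin best_in best]
      is_arg_max_partial_maximization[where h = ?h, OF best_in best]
    by blast
qed

end
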